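(* Suppose $f(x,\theta)$ is continuously differentiable in $x$ for all $\theta\in\Theta$ and $g$ is continuously differentiable. Suppose there are constants $G_{f,x},G_g>0$ such that $\|\nabla_x f(x_1,\theta)-\nabla_x f(x_2,\theta)\|\le G_{f,x}\|x_1-x_2\|$ for all $x_1,x_2\in X$, $\theta\in\Theta$, and $\nabla_\theta g$ is Lipschitz continuous with constant $G_g$. Suppose $f(\cdot,\theta)$ is strongly convex with constant $\eta_f>0$ for all $\theta\in\Theta$, and $g$ is strongly convex with constant $\eta_g>0$. Let $\theta^*$ be the minimizer of $g$ over $\Theta$ and $x^*$ the minimizer of $f(\cdot,\theta^* )$ over $X$, and suppose $\theta\mapsto\nabla_x f(x^*,\theta)$ is Lipschitz continuous on $\Theta$ with constant $L_\theta$. Let $\{\gamma_{f,k}\}$ be a diminishing nonnegative sequence with $\sum_{k=1}^\infty\gamma_{f,k}=\infty$ and $\sum_{k=1}^\infty\gamma_{f,k}^2<\infty$, and let $\gamma_{g,k}=\gamma_g$ for all $k$ with $0<\gamma_g<2/G_g$. Then, for any $x_0\in X$, $\theta_0\in\Theta$, the sequence $\{(x_k,\theta_k)\}$ generated by the joint gradient scheme satisfies $x_k\to x^*$ and $\theta_k\to\theta^*$ as $k\to\infty$.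
   Context: $X\subseteq\mathbb{R}^n$ and $\Theta\subseteq\mathbb{R}^m$ are nonempty closed convex sets, $f:X\times\Theta\to\mathbb{R}$ is convex in $x$ for every $\theta\in\Theta$, and $g:\mathbb{R}^m\to\mathbb{R}$ is convex. $\Pi_Y$ denotes Euclidean projection onto $Y$. A differentiable function $h$ is strongly convex with constant $\eta$ if $(\nabla h(u)-\nabla h(v))^T(u-v)\ge\eta\|u-v\|^2$ for all $u,v$ in its domain of interest. "Diminishing" means tending to $0$. The joint gradient scheme, given $x_0\in X$, $\theta_0\in\Theta$ and steplengths $\{\gamma_{f,k}\},\{\gamma_{g,k}\}$, is: for all $k\ge0$, $x_{k+1}=\Pi_X(x_k-\gamma_{f,k}\nabla_x f(x_k,\theta_k))$ and $\theta_{k+1}=\Pi_\Theta(\theta_k-\gamma_{g,k}\nabla_\theta g(\theta_k))$. *)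

theory Defs
  imports "HOL-Analysis.Analysis"
begin

(* The gradient is taken relative to S, so that it makes sense at boundary points of S for a
   function that is only meaningful on S.  If h is differentiable on a neighbourhood of S, its
   ordinary gradient satisfies this.  If S has empty interior, dh need not be unique. *)
definition has_gradient_on ::
  "('a::euclidean_space \<Rightarrow> real) \<Rightarrow> ('a \<Rightarrow> 'a) \<Rightarrow> 'a set \<Rightarrow> bool" where
  "has_gradient_on h dh S \<longleftrightarrow> (\<forall>x\<in>S. (h has_derivative (\<lambda>v. dh x \<bullet> v)) (at x within S))"

definition continuously_differentiable_on ::
  "('a::euclidean_space \<Rightarrow> real) \<Rightarrow> ('a \<Rightarrow> 'a) \<Rightarrow> 'a set \<Rightarrow> bool" where
  "continuously_differentiable_on h dh S \<longleftrightarrow> has_gradient_on h dh S \<and> continuous_on S dh"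

definition strongly_convex_on ::
  "('a::euclidean_space \<Rightarrow> real) \<Rightarrow> ('a \<Rightarrow> 'a) \<Rightarrow> real \<Rightarrow> 'a set \<Rightarrow> bool" where
  "strongly_convex_on h dh \<eta> S \<longleftrightarrow> has_gradient_on h dh S \<and>
     (\<forall>u\<in>S. \<forall>v\<in>S. (dh u - dh v) \<bullet> (u - v) \<ge> \<eta> * (norm (u - v))\<^sup>2)"

definition joint_gradient_scheme ::
  "'a::euclidean_space set \<Rightarrow> 'b::euclidean_space set \<Rightarrow> ('a \<Rightarrow> 'b \<Rightarrow> 'a) \<Rightarrow> ('b \<Rightarrow> 'b)
     \<Rightarrow> (nat \<Rightarrow> real) \<Rightarrow> (nat \<Rightarrow> real) \<Rightarrow> 'a \<Rightarrow> 'b \<Rightarrow> (nat \<Rightarrow> 'a) \<Rightarrow> (nat \<Rightarrow> 'b) \<Rightarrow> bool" where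
  "joint_gradient_scheme X \<Theta> df dg \<gamma>f \<gamma>g x0 \<theta>0 x \<theta> \<longleftrightarrow>
     x 0 = x0 \<and> \<theta> 0 = \<theta>0 \<and>
     (\<forall>k. x (Suc k) = closest_point X (x k - \<gamma>f k *\<^sub>R df (x k) (\<theta> k)) \<and>
          \<theta> (Suc k) = closest_point \<Theta> (\<theta> k - \<gamma>g k *\<^sub>R dg (\<theta> k)))"

end

theory Submission
  imports Defs
begin

text \<open>
  The projected gradient steps in $\theta$ decrease $g$ by at least a multiple of
  $\|\theta_{k+1} - \theta_k\|^2$, because the step length is below $2/G_g$. As $g$ is bounded below
  on $\Theta$, the increments tend to $0$, and strong monotonicity bounds the distance from
  $\theta_{k+1}$ to the minimizer by a multiple of the increment. For $x$, nonexpansiveness of the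
  projection gives $e_{k+1} \le (1 - \gamma_k \eta_f/2) e_k + \gamma_k L \|\theta_k - \theta^*\|$
  for the errors $e_k = \|x_k - x^*\|$ once $\gamma_k$ is small. Since the steps are not summable
  and the perturbation is $\gamma_k$ times a null sequence, $e_k$ tends to $0$.
\<close>

section \<open>Differentiation along segments of a convex set\<close>

lemma has_gradient_on_segment:
  fixes u v :: "'a::euclidean_space"
  assumes grad: "has_gradient_on h dh S" and S: "convex S" "u \<in> S" "v \<in> S" and t: "t \<in> {0..1}"
  shows "((\<lambda>t. h (u + t *\<^sub>R (v - u))) has_real_derivative
            dh (u + t *\<^sub>R (v - u)) \<bullet> (v - u)) (at t within {0..1})"
proof -
  let ?p = "\<lambda>t::real. u + t *\<^sub>R (v - u)"
  have mem: "?p r \<in> S" if "r \<in> {0..1}" for r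
    using convexD_alt[OF S, of r] that by (simp add: algebra_simps)
  \<comment> \<open>By convexity the segment stays in \<open>S\<close>, so the relative gradient may
    be restricted to the segment, which is the form the chain rule within a set asks for.\<close>
  have "(h has_derivative (\<lambda>w. dh (?p t) \<bullet> w)) (at (?p t) within ?p ` {0..1})"
    using grad mem t unfolding has_gradient_on_def by (blast intro: has_derivative_subset)
  moreover have "(?p has_derivative (\<lambda>r. r *\<^sub>R (v - u))) (at t within {0..1})"
    by (auto intro!: derivative_eq_intros)
  ultimately have "((\<lambda>t. h (?p t)) has_derivative (\<lambda>r. dh (?p t) \<bullet> (r *\<^sub>R (v - u))))
      (at t within {0..1})"
    by (rule has_derivative_in_compose[rotated])
  then show ?thesis
    by (simp add: has_field_derivative_def mult_commute_abs)
qed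

text \<open>A negative slope at \<open>s\<close> towards \<open>y\<close> would make
  \<open>h\<close> drop strictly below its minimum at nearby points of the segment, which still lie
  in \<open>S\<close>.\<close>

lemma first_order_optimality:
  fixes s y :: "'a::euclidean_space"
  assumes grad: "has_gradient_on h dh S" and "convex S"
    and min: "is_arg_min h (\<lambda>y. y \<in> S) s" and y: "y \<in> S"
  shows "0 \<le> dh s \<bullet> (y - s)"
proof (rule ccontr)
  assume neg: "\<not> 0 \<le> dh s \<bullet> (y - s)"
  have s: "s \<in> S" and le: "\<And>z. z \<in> S \<Longrightarrow> h s \<le> h z"
    using min by (auto simp: is_arg_min_linorder)
  let ?\<phi> = "\<lambda>t::real. h (s + t *\<^sub>R (y - s))"
  have "(?\<phi> has_real_derivative dh s \<bullet> (y - s)) (at 0 within {0..1})"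
    using has_gradient_on_segment[OF grad \<open>convex S\<close> s y, of 0] by simp
  with neg obtain d where d: "d > 0"
    and dec: "\<And>t. t > 0 \<Longrightarrow> 0 + t \<in> {0..1} \<Longrightarrow> t < d \<Longrightarrow> ?\<phi> (0 + t) < ?\<phi> 0"
    using has_real_derivative_neg_dec_right[of ?\<phi> "dh s \<bullet> (y - s)" 0 "{0..1}"] by force
  define t where "t = min 1 (d / 2)"
  have t: "t > 0" "t \<le> 1" "t < d" using d by (auto simp: t_def)
  have "s + t *\<^sub>R (y - s) \<in> S"
    using convexD_alt[OF \<open>convex S\<close> s y, of t] t by (simp add: algebra_simps)
  then show False using le dec[of t] t by force
qed

text \<open>At time \<open>t\<close> on the segment the slope exceeds its initial value by at most
  \<open>G * t * (norm (v - u))\<^sup>2\<close>; accumulated over the unit interval this gives the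
  factor 1/2.\<close>

lemma descent_lemma:
  fixes u v :: "'a::euclidean_space"
  assumes grad: "has_gradient_on h dh S" and S: "convex S" "u \<in> S" "v \<in> S"
    and lip: "G-lipschitz_on S dh"
  shows "h v \<le> h u + dh u \<bullet> (v - u) + G / 2 * (norm (v - u))\<^sup>2"
proof -
  let ?d = "v - u"
  let ?p = "\<lambda>t::real. u + t *\<^sub>R ?d"
  \<comment> \<open>The claim is \<open>?\<psi> 1 \<le> ?\<psi> 0\<close>. The mean value theorem
    takes the place of an integral, so the sign of \<open>?\<psi>'\<close> at one interior point
    suffices.\<close>
  let ?\<psi> = "\<lambda>t::real. h (?p t) - t * (dh u \<bullet> ?d) - G * t\<^sup>2 / 2 * (norm ?d)\<^sup>2"
  let ?\<psi>' = "\<lambda>t::real. dh (?p t) \<bullet> ?d - dh u \<bullet> ?d - G * t * (norm ?d)\<^sup>2"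
  have "(?\<psi> has_derivative (*) (?\<psi>' t)) (at t within {0..1})" if "0 \<le> t" "t \<le> 1" for t
    unfolding has_field_derivative_def[symmetric]
    using has_gradient_on_segment[OF grad S, of t] that by (auto intro!: derivative_eq_intros)
  then obtain t where t: "0 < t" "t < 1" and eq: "?\<psi> 1 - ?\<psi> 0 = ?\<psi>' t * (1 - 0)"
    using mvt_simple[of 0 1 ?\<psi> "\<lambda>t. (*) (?\<psi>' t)"] by auto
  have "?p t \<in> S" using convexD_alt[OF S, of t] t by (simp add: algebra_simps)
  then have "norm (dh (?p t) - dh u) \<le> G * (t * norm ?d)"
    using lipschitz_onD[OF lip, of "?p t" u] S t by (simp add: dist_norm)
  then have "norm (dh (?p t) - dh u) * norm ?d \<le> G * (t * norm ?d) * norm ?d"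
    by (rule mult_right_mono) simp
  with norm_cauchy_schwarz[of "dh (?p t) - dh u" ?d] have "?\<psi>' t \<le> 0"
    by (simp add: inner_diff_left power2_eq_square algebra_simps)
  with eq show ?thesis by simp
qed

section \<open>Projected gradient iteration with constant step\<close>

lemma projected_gradient_convergence:
  fixes \<theta> :: "nat \<Rightarrow> 'a::euclidean_space"
  assumes S: "closed S" "convex S"
    and sc: "strongly_convex_on g dg \<eta> S" and "\<eta> > 0"
    and lip: "G-lipschitz_on S dg" and "G > 0"
    and min: "is_arg_min g (\<lambda>t. t \<in> S) s"
    and c: "0 < c" "c < 2 / G"
    and init: "\<theta> 0 \<in> S"
    and step: "\<And>k. \<theta> (Suc k) = closest_point S (\<theta> k - c *\<^sub>R dg (\<theta> k))"
  shows "\<theta> \<longlonglongrightarrow> s"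
proof -
  have grad: "has_gradient_on g dg S"
    and mono: "\<And>u v. u \<in> S \<Longrightarrow> v \<in> S \<Longrightarrow> (dg u - dg v) \<bullet> (u - v) \<ge> \<eta> * (norm (u - v))\<^sup>2"
    using sc by (auto simp: strongly_convex_on_def)
  have s: "s \<in> S" and low: "\<And>z. z \<in> S \<Longrightarrow> g s \<le> g z"
    using min by (auto simp: is_arg_min_linorder)
  have mem: "\<theta> k \<in> S" for k
  proof (cases k)
    case (Suc j)
    then show ?thesis using step closest_point_in_set[OF \<open>closed S\<close>] init by auto
  qed (use init in simp)
  define d where "d k = \<theta> (Suc k) - \<theta> k" for k
  \<comment> \<open>Variational inequality of the projection: the residual, namely the unprojected
    point minus \<open>\<theta> (Suc k)\<close>, makes no acute angle with any direction into
    \<open>S\<close>.\<close>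
  have proj: "(- d k - c *\<^sub>R dg (\<theta> k)) \<bullet> (y - \<theta> (Suc k)) \<le> 0" if "y \<in> S" for y k
    using closest_point_dot[OF S(2,1) that, of "\<theta> k - c *\<^sub>R dg (\<theta> k)"]
    by (simp add: step[symmetric] d_def algebra_simps)
  \<comment> \<open>The projection yields a decrease with coefficient \<open>1 / c\<close>, and the
    descent lemma gives back at most \<open>G / 2\<close>. The condition \<open>c < 2 / G\<close>
    makes the balance positive.\<close>
  define a where "a = 1 / c - G / 2"
  have "a > 0" using c \<open>G > 0\<close> by (simp add: a_def field_simps)
  have dec: "a * (norm (d k))\<^sup>2 \<le> g (\<theta> k) - g (\<theta> (Suc k))" for k
  proof -
    \<comment> \<open>The variational inequality tested at the previous iterate.\<close>
    have "c * (dg (\<theta> k) \<bullet> d k) \<le> - (norm (d k))\<^sup>2"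
      using proj[OF mem, of k k]
      by (simp add: d_def power2_norm_eq_inner inner_diff_left inner_diff_right algebra_simps
          inner_commute)
    then have "dg (\<theta> k) \<bullet> d k \<le> - (norm (d k))\<^sup>2 / c"
      using c by (simp add: field_simps)
    moreover have "g (\<theta> (Suc k)) \<le> g (\<theta> k) + dg (\<theta> k) \<bullet> d k + G / 2 * (norm (d k))\<^sup>2"
      unfolding d_def by (rule descent_lemma[OF grad S(2) mem mem lip])
    ultimately show ?thesis by (simp add: a_def algebra_simps)
  qed
  have "decseq (\<lambda>k. g (\<theta> k))"
    using dec \<open>a > 0\<close> by (intro decseq_SucI) (smt (verit) mult_nonneg_nonneg zero_le_power2)
  then obtain l where l: "(\<lambda>k. g (\<theta> k)) \<longlonglongrightarrow> l"
    using decseq_convergent[of "\<lambda>k. g (\<theta> k)" "g s"] low[OF mem] by blast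
  \<comment> \<open>Consecutive values of \<open>g\<close> share the limit \<open>l\<close>, so
    their gap vanishes and, by \<open>dec\<close>, squeezes the squared increments to 0.\<close>
  have "(\<lambda>k. (g (\<theta> k) - g (\<theta> (Suc k))) / a) \<longlonglongrightarrow> (l - l) / a"
    by (intro tendsto_intros l LIMSEQ_Suc[OF l]) (use \<open>a > 0\<close> in simp)
  then have gap: "(\<lambda>k. (g (\<theta> k) - g (\<theta> (Suc k))) / a) \<longlonglongrightarrow> 0" by simp
  have "(\<lambda>k. (norm (d k))\<^sup>2) \<longlonglongrightarrow> 0"
    by (rule tendsto_sandwich[OF _ _ tendsto_const gap])
      (use dec \<open>a > 0\<close> in \<open>auto simp: field_simps\<close>)
  then have d0: "(\<lambda>k. norm (d k)) \<longlonglongrightarrow> 0"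
    using tendsto_real_sqrt by fastforce
  have bound: "norm (\<theta> (Suc k) - s) \<le> (1 + c * G) / (c * \<eta>) * norm (d k)" for k
  proof -
    let ?e = "\<theta> (Suc k) - s"
    \<comment> \<open>Three inequalities are added: the variational inequality tested at
      \<open>s\<close>, strong monotonicity between \<open>\<theta> (Suc k)\<close> and
      \<open>s\<close>, and optimality of \<open>s\<close>. What remains on the right is the change
      of the gradient over one step and the increment, both controlled by
      \<open>norm (d k)\<close>.\<close>
    have "c * (dg (\<theta> k) \<bullet> ?e) \<le> - (d k \<bullet> ?e)"
      using proj[OF s, of k] by (simp add: algebra_simps)
    moreover have "c * (\<eta> * (norm ?e)\<^sup>2) \<le> c * ((dg (\<theta> (Suc k)) - dg s) \<bullet> ?e)"
      using mono[OF mem s] c by (intro mult_left_mono) auto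
    moreover have "0 \<le> c * (dg s \<bullet> ?e)"
      using first_order_optimality[OF grad S(2) min mem] c by simp
    ultimately have "c * \<eta> * (norm ?e)\<^sup>2 \<le> (c *\<^sub>R (dg (\<theta> (Suc k)) - dg (\<theta> k)) - d k) \<bullet> ?e"
      by (simp add: inner_diff_left algebra_simps)
    also have "\<dots> \<le> norm (c *\<^sub>R (dg (\<theta> (Suc k)) - dg (\<theta> k)) - d k) * norm ?e"
      by (rule norm_cauchy_schwarz)
    also have "\<dots> \<le> ((1 + c * G) * norm (d k)) * norm ?e"
    proof (rule mult_right_mono)
      have "norm (dg (\<theta> (Suc k)) - dg (\<theta> k)) \<le> G * norm (d k)"
        using lipschitz_onD[OF lip mem mem] by (simp add: dist_norm d_def)
      then have "norm (c *\<^sub>R (dg (\<theta> (Suc k)) - dg (\<theta> k))) \<le> c * (G * norm (d k))"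
        using c by simp
      then show "norm (c *\<^sub>R (dg (\<theta> (Suc k)) - dg (\<theta> k)) - d k) \<le> (1 + c * G) * norm (d k)"
        using norm_triangle_ineq4[of "c *\<^sub>R (dg (\<theta> (Suc k)) - dg (\<theta> k))" "d k"]
        by (simp add: algebra_simps)
    qed simp
    finally have "(c * \<eta> * norm ?e) * norm ?e \<le> ((1 + c * G) * norm (d k)) * norm ?e"
      by (simp add: power2_eq_square mult.assoc)
    \<comment> \<open>One factor \<open>norm ?e\<close> cancels unless it is 0, and then the bound
      is trivial.\<close>
    then have "c * \<eta> * norm ?e \<le> (1 + c * G) * norm (d k) \<or> ?e = 0"
      by (metis mult_right_le_imp_le zero_less_norm_iff)
    then show ?thesis
      using c \<open>\<eta> > 0\<close> \<open>G > 0\<close> by (auto simp: field_simps)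
  qed
  have "(\<lambda>k. (1 + c * G) / (c * \<eta>) * norm (d k)) \<longlonglongrightarrow> 0"
    using tendsto_mult_right_zero[OF d0] by blast
  then have "(\<lambda>k. \<theta> (Suc k) - s) \<longlonglongrightarrow> 0"
    by (rule Lim_null_comparison[OF always_eventually, rotated]) (use bound in blast)
  then show ?thesis
    by (simp add: LIM_zero_iff filterlim_sequentially_Suc)
qed

section \<open>A scalar recursion with vanishing perturbation\<close>

text \<open>Eventually each new term is at most a weighted average of the old term and
  \<open>\<epsilon> k\<close>. Divergence of the sum of the weights \<open>\<beta> k\<close> makes
  the initial value forgotten, leaving only the null sequence.\<close>

lemma damped_recursion_tendsto_zero:
  fixes a \<beta> \<epsilon> :: "nat \<Rightarrow> real"
  assumes nonneg: "\<And>k. 0 \<le> a k"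
    and \<beta>: "\<forall>\<^sub>F k in sequentially. 0 \<le> \<beta> k \<and> \<beta> k \<le> 1"
    and div: "filterlim (\<lambda>n. \<Sum>k<n. \<beta> k) at_top sequentially"
    and \<epsilon>: "\<epsilon> \<longlonglongrightarrow> 0"
    and rec: "\<forall>\<^sub>F k in sequentially. a (Suc k) \<le> (1 - \<beta> k) * a k + \<beta> k * \<epsilon> k"
  shows "a \<longlonglongrightarrow> 0"
proof (rule order_tendstoI)
  fix e :: real assume "e > 0"
  \<comment> \<open>Half of the tolerance covers the perturbation, the other half the decaying
    initial value.\<close>
  define \<delta> where "\<delta> = e / 2"
  have "\<delta> > 0" using \<open>e > 0\<close> by (simp add: \<delta>_def)
  have "\<forall>\<^sub>F k in sequentially. (0 \<le> \<beta> k \<and> \<beta> k \<le> 1)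
      \<and> a (Suc k) \<le> (1 - \<beta> k) * a k + \<beta> k * \<epsilon> k \<and> \<epsilon> k < \<delta>"
    using \<beta> rec order_tendstoD(2)[OF \<epsilon> \<open>\<delta> > 0\<close>] by (auto simp: eventually_conj_iff)
  then obtain N where N: "\<And>k. k \<ge> N \<Longrightarrow> 0 \<le> \<beta> k \<and> \<beta> k \<le> 1"
      "\<And>k. k \<ge> N \<Longrightarrow> a (Suc k) \<le> (1 - \<beta> k) * a k + \<beta> k * \<epsilon> k" "\<And>k. k \<ge> N \<Longrightarrow> \<epsilon> k < \<delta>"
    by (auto simp: eventually_sequentially)
  let ?s = "\<lambda>n. \<Sum>k<n. \<beta> k"
  \<comment> \<open>The product of the factors \<open>1 - \<beta> k\<close> from \<open>N\<close> to
    \<open>n - 1\<close> is replaced by its upper bound, the exponential of minus the sum of these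
    \<open>\<beta> k\<close>.\<close>
  let ?b = "\<lambda>n. exp (?s N - ?s n) * a N"
  have claim: "a n \<le> \<delta> + ?b n" if "n \<ge> N" for n
    using that
  proof (induction n rule: dec_induct)
    case base
    then show ?case using \<open>\<delta> > 0\<close> by simp
  next
    case (step n)
    have \<beta>n: "0 \<le> \<beta> n" "\<beta> n \<le> 1" and \<epsilon>n: "\<epsilon> n \<le> \<delta>" using N(1,3)[of n] step by auto
    have "a (Suc n) \<le> (1 - \<beta> n) * a n + \<beta> n * \<epsilon> n" using N(2) step by simp
    also have "\<dots> \<le> (1 - \<beta> n) * (\<delta> + ?b n) + \<beta> n * \<delta>"
      using \<beta>n \<epsilon>n step.IH by (intro add_mono mult_left_mono) auto
    also have "\<dots> = \<delta> + (1 - \<beta> n) * ?b n" by (simp add: algebra_simps)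
    also have "\<dots> \<le> \<delta> + exp (- \<beta> n) * ?b n"
      using exp_ge_add_one_self[of "- \<beta> n"] nonneg by (intro add_left_mono mult_right_mono) auto
    also have "\<dots> = \<delta> + ?b (Suc n)"
      by (simp add: exp_diff exp_add exp_minus field_simps)
    finally show ?case .
  qed
  \<comment> \<open>Divergence of the sum sends the exponent to minus infinity.\<close>
  have "filterlim (\<lambda>n. ?s N - ?s n) at_bot sequentially"
    using filterlim_tendsto_add_at_top[OF tendsto_const[of "- ?s N"] div]
    by (simp add: filterlim_uminus_at_top)
  then have "(\<lambda>n. exp (?s N - ?s n)) \<longlonglongrightarrow> 0"
    by (rule filterlim_compose[OF exp_at_bot])
  then have "?b \<longlonglongrightarrow> 0" by (rule tendsto_mult_left_zero)
  from order_tendstoD(2)[OF this \<open>\<delta> > 0\<close>] eventually_ge_at_top[of N]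
  show "\<forall>\<^sub>F n in sequentially. a n < e"
  proof eventually_elim
    case (elim n)
    then show ?case using claim[of n] by (simp add: \<delta>_def)
  qed
qed (use nonneg in \<open>auto intro: always_eventually less_le_trans\<close>)

section \<open>Fixed point and contraction for the step in x\<close>

text \<open>Testing the variational inequality of the projection at \<open>s\<close>, the term with
  \<open>v\<close> has a favourable sign and leaves only the squared distance. Hence the minimizer
  is fixed by its own projected gradient step, whatever the step length.\<close>

lemma closest_point_fixed:
  fixes s :: "'a::euclidean_space"
  assumes S: "closed S" "convex S" "s \<in> S"
    and opt: "\<And>y. y \<in> S \<Longrightarrow> 0 \<le> v \<bullet> (y - s)" and "r \<ge> 0"
  shows "closest_point S (s - r *\<^sub>R v) = s"
proof -
  let ?p = "closest_point S (s - r *\<^sub>R v)"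
  have "?p \<in> S" using closest_point_in_set S by blast
  then have "0 \<le> r * (v \<bullet> (?p - s))" using opt \<open>r \<ge> 0\<close> by simp
  moreover have "(s - r *\<^sub>R v - ?p) \<bullet> (s - ?p) \<le> 0"
    by (rule closest_point_dot[OF S(2,1,3)])
  ultimately have "(norm (s - ?p))\<^sup>2 \<le> 0"
    by (simp add: power2_norm_eq_inner algebra_simps)
  then show ?thesis by simp
qed

text \<open>Here \<open>w\<close> stands for a difference of points and \<open>z\<close> for the
  difference of their gradients. Expanding the square, strong monotonicity gains
  \<open>2 * r * \<eta>\<close>; for small \<open>r\<close> half of this pays for the quadratic
  term.\<close>

lemma gradient_step_contraction:
  fixes w z :: "'a::real_inner"
  assumes lip: "norm z \<le> G * norm w" and mono: "\<eta> * (norm w)\<^sup>2 \<le> z \<bullet> w"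
    and r: "0 \<le> r" "r * G\<^sup>2 \<le> \<eta>" "r * \<eta> \<le> 1"
  shows "norm (w - r *\<^sub>R z) \<le> (1 - \<eta> / 2 * r) * norm w"
proof (rule power2_le_imp_le)
  have "(norm z)\<^sup>2 \<le> G\<^sup>2 * (norm w)\<^sup>2"
    using power_mono[OF lip norm_ge_zero, of 2] by (simp add: power_mult_distrib)
  then have "r\<^sup>2 * (norm z)\<^sup>2 \<le> r\<^sup>2 * (G\<^sup>2 * (norm w)\<^sup>2)" by (rule mult_left_mono) simp
  also have "\<dots> = r * (r * G\<^sup>2) * (norm w)\<^sup>2" by (simp add: power2_eq_square)
  also have "\<dots> \<le> r * \<eta> * (norm w)\<^sup>2"
    using r by (intro mult_right_mono mult_left_mono) auto
  finally have sq: "r\<^sup>2 * (norm z)\<^sup>2 \<le> r * \<eta> * (norm w)\<^sup>2" .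
  have "r * (\<eta> * (norm w)\<^sup>2) \<le> r * (z \<bullet> w)" using mono r by (intro mult_left_mono) auto
  moreover have "(norm (w - r *\<^sub>R z))\<^sup>2 = (norm w)\<^sup>2 - 2 * (r * (z \<bullet> w)) + r\<^sup>2 * (norm z)\<^sup>2"
    unfolding power2_norm_eq_inner
    by (simp add: inner_diff_left inner_diff_right inner_commute power2_eq_square algebra_simps)
  ultimately have "(norm (w - r *\<^sub>R z))\<^sup>2 \<le> (1 - \<eta> * r) * (norm w)\<^sup>2"
    using sq by (simp add: algebra_simps)
  \<comment> \<open>Completing the square gives a bound whose root is linear in
    \<open>r\<close>.\<close>
  also have "\<dots> \<le> (1 - \<eta> / 2 * r)\<^sup>2 * (norm w)\<^sup>2"
    using zero_le_power2[of "\<eta> / 2 * r"]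
    by (intro mult_right_mono) (auto simp: power2_diff)
  finally show "(norm (w - r *\<^sub>R z))\<^sup>2 \<le> ((1 - \<eta> / 2 * r) * norm w)\<^sup>2"
    by (simp add: power_mult_distrib)
  show "0 \<le> (1 - \<eta> / 2 * r) * norm w"
    using r by (intro mult_nonneg_nonneg) (auto simp: mult.commute)
qed

section \<open>Joint convergence of both iterations\<close>

theorem proposition3:
  fixes X :: "(real^'n) set" and \<Theta> :: "(real^'m) set"
    and f :: "real^'n \<Rightarrow> real^'m \<Rightarrow> real" and df :: "real^'n \<Rightarrow> real^'m \<Rightarrow> real^'n"
    and g :: "real^'m \<Rightarrow> real" and dg :: "real^'m \<Rightarrow> real^'m"
    and Gf Gg \<eta>f \<eta>g L c :: real
    and \<gamma>f \<gamma>g :: "nat \<Rightarrow> real"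
    and xs x0 :: "real^'n" and \<theta>s \<theta>0 :: "real^'m"
    and x :: "nat \<Rightarrow> real^'n" and \<theta> :: "nat \<Rightarrow> real^'m"
  assumes "X \<noteq> {}" "closed X" "convex X"
    and "\<Theta> \<noteq> {}" "closed \<Theta>" "convex \<Theta>"
    and "\<And>t. t \<in> \<Theta> \<Longrightarrow> convex_on X (\<lambda>y. f y t)"
    and "convex_on UNIV g"
    and "\<And>t. t \<in> \<Theta> \<Longrightarrow> continuously_differentiable_on (\<lambda>y. f y t) (\<lambda>y. df y t) X"
    and "continuously_differentiable_on g dg UNIV"
    and "Gf > 0" "Gg > 0"
    and "\<And>y z t. y \<in> X \<Longrightarrow> z \<in> X \<Longrightarrow> t \<in> \<Theta> \<Longrightarrow> norm (df y t - df z t) \<le> Gf * norm (y - z)"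
    and "Gg-lipschitz_on \<Theta> dg"
    and "\<eta>f > 0" "\<And>t. t \<in> \<Theta> \<Longrightarrow> strongly_convex_on (\<lambda>y. f y t) (\<lambda>y. df y t) \<eta>f X"
    and "\<eta>g > 0" "strongly_convex_on g dg \<eta>g \<Theta>"
    and "is_arg_min g (\<lambda>t. t \<in> \<Theta>) \<theta>s"
    and "is_arg_min (\<lambda>y. f y \<theta>s) (\<lambda>y. y \<in> X) xs"
    and "L-lipschitz_on \<Theta> (\<lambda>t. df xs t)"
    and "\<And>k. \<gamma>f k \<ge> 0" "\<gamma>f \<longlonglongrightarrow> 0"
    and "filterlim (\<lambda>N. \<Sum>k=1..N. \<gamma>f k) at_top sequentially"
    and "summable (\<lambda>k. (\<gamma>f (Suc k))\<^sup>2)"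
    and "\<And>k. \<gamma>g k = c" "0 < c" "c < 2 / Gg"
    and "x0 \<in> X" "\<theta>0 \<in> \<Theta>"
    and "joint_gradient_scheme X \<Theta> df dg \<gamma>f \<gamma>g x0 \<theta>0 x \<theta>"
  shows "x \<longlonglongrightarrow> xs \<and> \<theta> \<longlonglongrightarrow> \<theta>s"
proof -
  have X: "closed X" "convex X" using assms(2,3) .
  have \<Theta>: "closed \<Theta>" "convex \<Theta>" using assms(5,6) .
  have lipf: "\<And>y z t. y \<in> X \<Longrightarrow> z \<in> X \<Longrightarrow> t \<in> \<Theta> \<Longrightarrow> norm (df y t - df z t) \<le> Gf * norm (y - z)"
    by (fact assms(13))
  have \<eta>f: "\<eta>f > 0" by (fact assms(15))
  have scf: "\<And>t. t \<in> \<Theta> \<Longrightarrow> strongly_convex_on (\<lambda>y. f y t) (\<lambda>y. df y t) \<eta>f X" by (fact assms(16))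
  have ming: "is_arg_min g (\<lambda>t. t \<in> \<Theta>) \<theta>s" by (fact assms(19))
  have minf: "is_arg_min (\<lambda>y. f y \<theta>s) (\<lambda>y. y \<in> X) xs" by (fact assms(20))
  have lipL: "L-lipschitz_on \<Theta> (\<lambda>t. df xs t)" by (fact assms(21))
  have \<gamma>0: "\<And>k. \<gamma>f k \<ge> 0" and \<gamma>lim: "\<gamma>f \<longlonglongrightarrow> 0" by (fact assms(22), fact assms(23))
  have \<gamma>div: "filterlim (\<lambda>N. \<Sum>k=1..N. \<gamma>f k) at_top sequentially" by (fact assms(24))
  have init: "x 0 \<in> X" "\<theta> 0 \<in> \<Theta>"
    and xstep: "\<And>k. x (Suc k) = closest_point X (x k - \<gamma>f k *\<^sub>R df (x k) (\<theta> k))"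
    and \<theta>step: "\<And>k. \<theta> (Suc k) = closest_point \<Theta> (\<theta> k - c *\<^sub>R dg (\<theta> k))"
    using assms(26,29-31) by (auto simp: joint_gradient_scheme_def)
  \<comment> \<open>The iteration in \<theta> does not involve x, so it can be treated
    first.\<close>
  have \<theta>lim: "\<theta> \<longlonglongrightarrow> \<theta>s"
    by (rule projected_gradient_convergence[OF \<Theta> assms(18,17,14,12) ming assms(27,28) init(2) \<theta>step])
  have xmem: "x k \<in> X" for k
  proof (cases k)
    case (Suc j)
    then show ?thesis using xstep closest_point_in_set[OF X(1)] init(1) by auto
  qed (use init in simp)
  have \<theta>mem: "\<theta> k \<in> \<Theta>" for k
  proof (cases k)
    case (Suc j)
    then show ?thesis using \<theta>step closest_point_in_set[OF \<Theta>(1)] init(2) by auto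
  qed (use init in simp)
  have xs: "xs \<in> X" and \<theta>s: "\<theta>s \<in> \<Theta>"
    using minf ming by (auto simp: is_arg_min_def)
  have gradf: "has_gradient_on (\<lambda>y. f y \<theta>s) (\<lambda>y. df y \<theta>s) X"
    using scf[OF \<theta>s] by (simp add: strongly_convex_on_def)
  have fixed: "closest_point X (xs - r *\<^sub>R df xs \<theta>s) = xs" if "r \<ge> 0" for r
    by (rule closest_point_fixed[OF X xs first_order_optimality[OF gradf X(2) minf] that])
  \<comment> \<open>The perturbation is
    \<open>\<gamma>f k * L * norm (\<theta> k - \<theta>s)\<close>, rescaled so that the damping
    weight \<open>\<eta>f / 2 * \<gamma>f k\<close> appears as its factor.\<close>
  have rec: "norm (x (Suc k) - xs) \<le> (1 - \<eta>f / 2 * \<gamma>f k) * norm (x k - xs)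
      + \<eta>f / 2 * \<gamma>f k * (2 * L / \<eta>f * norm (\<theta> k - \<theta>s))"
    if small: "\<gamma>f k * Gf\<^sup>2 \<le> \<eta>f" "\<gamma>f k * \<eta>f \<le> 1" for k
  proof -
    \<comment> \<open>The gradient difference is split at \<open>df xs (\<theta> k)\<close>:
      \<open>?z\<close> varies the point at fixed parameter, where the contraction applies, and
      \<open>?q\<close> varies the parameter at \<open>xs\<close>, where the constant
      \<open>L\<close> applies.\<close>
    let ?z = "df (x k) (\<theta> k) - df xs (\<theta> k)" and ?q = "df xs (\<theta> k) - df xs \<theta>s"
    have "norm (x (Suc k) - xs)
        \<le> norm ((x k - \<gamma>f k *\<^sub>R df (x k) (\<theta> k)) - (xs - \<gamma>f k *\<^sub>R df xs \<theta>s))"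
      using closest_point_lipschitz[OF X(2,1), of "x k - \<gamma>f k *\<^sub>R df (x k) (\<theta> k)"
          "xs - \<gamma>f k *\<^sub>R df xs \<theta>s"] assms(1)
      by (simp add: dist_norm fixed[OF \<gamma>0] xstep)
    also have "\<dots> = norm (((x k - xs) - \<gamma>f k *\<^sub>R ?z) - \<gamma>f k *\<^sub>R ?q)"
      by (simp add: algebra_simps)
    also have "\<dots> \<le> norm ((x k - xs) - \<gamma>f k *\<^sub>R ?z) + norm (\<gamma>f k *\<^sub>R ?q)"
      by (rule norm_triangle_ineq4)
    also have "norm ((x k - xs) - \<gamma>f k *\<^sub>R ?z) \<le> (1 - \<eta>f / 2 * \<gamma>f k) * norm (x k - xs)"
      using scf[OF \<theta>mem] xmem xs
      by (intro gradient_step_contraction[OF lipf[OF xmem xs \<theta>mem] _ \<gamma>0 small])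
        (auto simp: strongly_convex_on_def)
    also have "norm (\<gamma>f k *\<^sub>R ?q) \<le> \<gamma>f k * (L * norm (\<theta> k - \<theta>s))"
      using lipschitz_onD[OF lipL \<theta>mem \<theta>s] \<gamma>0 by (simp add: dist_norm mult_left_mono)
    finally show ?thesis using \<eta>f by simp
  qed
  have "(\<lambda>k. norm (x k - xs)) \<longlonglongrightarrow> 0"
  proof (rule damped_recursion_tendsto_zero[where \<beta> = "\<lambda>k. \<eta>f / 2 * \<gamma>f k"
        and \<epsilon> = "\<lambda>k. 2 * L / \<eta>f * norm (\<theta> k - \<theta>s)"])
    have "(\<lambda>k. \<gamma>f k * Gf\<^sup>2) \<longlonglongrightarrow> 0" "(\<lambda>k. \<gamma>f k * \<eta>f) \<longlonglongrightarrow> 0"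
      using \<gamma>lim by (rule tendsto_mult_left_zero)+
    \<comment> \<open>Both thresholds of the contraction hold eventually because the steps
      diminish.\<close>
    then have small: "\<forall>\<^sub>F k in sequentially. \<gamma>f k * Gf\<^sup>2 < \<eta>f"
        "\<forall>\<^sub>F k in sequentially. \<gamma>f k * \<eta>f < 1"
      using order_tendstoD(2) \<eta>f zero_less_one by blast+
    show "\<forall>\<^sub>F k in sequentially. 0 \<le> \<eta>f / 2 * \<gamma>f k \<and> \<eta>f / 2 * \<gamma>f k \<le> 1"
      using small(2) by eventually_elim (use \<gamma>0 \<eta>f in \<open>auto simp: mult.commute\<close>)
    show "\<forall>\<^sub>F k in sequentially. norm (x (Suc k) - xs) \<le> (1 - \<eta>f / 2 * \<gamma>f k) * norm (x k - xs)
        + \<eta>f / 2 * \<gamma>f k * (2 * L / \<eta>f * norm (\<theta> k - \<theta>s))"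
      using small by eventually_elim (intro rec; simp)
    \<comment> \<open>Divergence is given for sums starting at 1, while the recursion sums from 0;
      the extra term \<open>\<gamma>f 0\<close> is nonnegative. At \<open>n = 0\<close> truncated
      subtraction makes the smaller sum empty.\<close>
    have "filterlim (\<lambda>n. \<Sum>k<n. \<gamma>f k) at_top sequentially"
    proof (rule filterlim_at_top_mono)
      show "filterlim (\<lambda>n. \<Sum>k=1..n-1. \<gamma>f k) at_top sequentially"
        using filterlim_compose[OF \<gamma>div filterlim_minus_const_nat_at_top[of 1]] .
      have "(\<Sum>k=1..n-1. \<gamma>f k) \<le> (\<Sum>k<n. \<gamma>f k)" for n
        by (rule sum_mono2) (use \<gamma>0 in auto)
      then show "\<forall>\<^sub>F n in sequentially. (\<Sum>k=1..n-1. \<gamma>f k) \<le> (\<Sum>k<n. \<gamma>f k)" by simp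
    qed
    then show "filterlim (\<lambda>n. \<Sum>k<n. \<eta>f / 2 * \<gamma>f k) at_top sequentially"
      using filterlim_tendsto_pos_mult_at_top[OF tendsto_const[of "\<eta>f / 2"]] \<eta>f
      by (simp add: sum_distrib_left[symmetric] del: times_divide_eq_left)
    have "(\<lambda>k. norm (\<theta> k - \<theta>s)) \<longlonglongrightarrow> 0"
      using \<theta>lim by (simp add: LIM_zero tendsto_norm_zero)
    then show "(\<lambda>k. 2 * L / \<eta>f * norm (\<theta> k - \<theta>s)) \<longlonglongrightarrow> 0"
      by (rule tendsto_mult_right_zero)
  qed simp
  then have "x \<longlonglongrightarrow> xs"
    by (simp add: tendsto_norm_zero_iff LIM_zero_iff)
  with \<theta>lim show ?thesis by blast
qed

end
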